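(* Let $f:\mathbb{R}\to\mathbb{R}$ be a Lebesgue measurable function. Suppose that there exists an integer $d\ge 0$ such that $$\Delta_{t_d}\cdots\Delta_{t_0} f(x)=0\quad\text{for all } x,t_0,\ldots,t_d\in\mathbb{R}.$$ Then $f$ is a polynomial of degree at most $d$; namely, there exist $a_0,\ldots,a_d\in\mathbb{R}$ such that $f(x)=a_0+a_1x+\cdots+a_dx^d$ for all $x\in\mathbb{R}$.
   Context: For $t\in\mathbb{R}$ and $f:\mathbb{R}\to\mathbb{R}$, the function $\Delta_t f:\mathbb{R}\to\mathbb{R}$ is defined by $\Delta_t f(x)=f(x+t)-f(x)$. The expression $\Delta_{t_d}\cdots\Delta_{t_0}f$ denotes successive application of these operators, $d+1$ of them, starting with $\Delta_{t_0}$. *)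

theory Defs
  imports "HOL-Analysis.Analysis"
begin

definition diff_op :: "real \<Rightarrow> (real \<Rightarrow> real) \<Rightarrow> real \<Rightarrow> real" where
  "diff_op t f = (\<lambda>x. f (x + t) - f x)"

(* iter_diff n t f applies the n operators with steps t 0, ..., t (n - 1), with t 0 innermost;
   so n = d + 1 gives the composition with steps t 0, ..., t d. *)
primrec iter_diff :: "nat \<Rightarrow> (nat \<Rightarrow> real) \<Rightarrow> (real \<Rightarrow> real) \<Rightarrow> real \<Rightarrow> real" where
  "iter_diff 0 t f = f"
| "iter_diff (Suc n) t f = diff_op (t n) (iter_diff n t f)"

end

theory Submission
  imports Defs "HOL-Computational_Algebra.Polynomial"
begin

text \<open>
  Induction on \<open>d\<close>. By the induction hypothesis each \<open>\<Delta>\<^sub>t f\<close> is a polynomial \<open>p\<^sub>t\<close> of degree less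
  than \<open>d\<close>. Since \<open>\<Delta>\<^bsub>s+t\<^esub> f(x) = \<Delta>\<^sub>s f(x + t) + \<Delta>\<^sub>t f(x)\<close> and translation preserves top coefficients,
  the coefficient \<open>a(t)\<close> of \<open>x\<^bsup>d-1\<^esup>\<close> in \<open>p\<^sub>t\<close> is additive in \<open>t\<close>; as a limit of measurable functions
  it is measurable, hence \<open>a(t) = c t\<close>: some set where \<open>a\<close> is bounded is so large that it meets all
  its small translates, which makes \<open>a\<close> bounded near \<open>0\<close>. Then \<open>f - (c/d) x\<^sup>d\<close> is annihilated by any \<open>d\<close> differences,
  and the induction hypothesis applies to it.
\<close>

section \<open>Measurable additive functions\<close>

lemma borel_measurable_lebesgue_translate:
  fixes f :: "real \<Rightarrow> real"
  assumes "f \<in> borel_measurable lebesgue"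
  shows "(\<lambda>x. f (x + t)) \<in> borel_measurable lebesgue"
  using borel_measurable_affine[OF assms, of 1 t] by (simp add: add.commute)

text \<open>The sets where \<open>\<bar>f t\<bar> \<le> n\<close> increase to \<open>{0..1}\<close>,
  so by continuity from below their measures tend to 1.\<close>

lemma measurable_bounded_on_large_subset:
  fixes f :: "real \<Rightarrow> real"
  assumes f: "f \<in> borel_measurable lebesgue" and "c < 1"
  obtains M where "{t \<in> {0..1}. \<bar>f t\<bar> \<le> M} \<in> lmeasurable"
    and "measure lebesgue {t \<in> {0..1}. \<bar>f t\<bar> \<le> M} > c"
proof -
  define A where "A n = {t \<in> {0..1}. \<bar>f t\<bar> \<le> real n}" for n
  have m: "A n \<in> lmeasurable" for n
  proof (rule bounded_set_imp_lmeasurable)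
    have "A n = {0..1} \<inter> {t. f t \<in> {- real n..real n}}"
      unfolding A_def by auto
    then show "A n \<in> sets lebesgue"
      using lebesgue_measurable_vimage_borel[OF f, of "{- real n..real n}"] by auto
    show "bounded (A n)"
      by (rule bounded_subset[OF bounded_closed_interval[of 0 1]]) (auto simp: A_def)
  qed
  have U: "(\<Union>n. A n) = {0..1}"
    unfolding A_def using real_arch_simple by auto
  have "(\<lambda>n. measure lebesgue (A n)) \<longlonglongrightarrow> measure lebesgue (\<Union>n. A n)"
  proof (rule Lim_measure_incseq)
    show "range A \<subseteq> sets lebesgue" using m by auto
    show "incseq A" unfolding A_def incseq_def by force
    show "emeasure lebesgue (\<Union> (range A)) \<noteq> \<infinity>" unfolding U by simp
  qed
  then have "(\<lambda>n. measure lebesgue (A n)) \<longlonglongrightarrow> 1"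
    unfolding U by simp
  from order_tendstoD(1)[OF this \<open>c < 1\<close>] obtain n where "c < measure lebesgue (A n)"
    by (auto simp: eventually_sequentially)
  with m[of n] show ?thesis
    using that[of "real n"] unfolding A_def by auto
qed

lemma additive_measurable_bounded:
  fixes a :: "real \<Rightarrow> real"
  assumes a: "a \<in> borel_measurable lebesgue"
    and add: "\<And>s t. a (s + t) = a s + a t"
  obtains C where "\<And>x. x \<in> {0..1/2} \<Longrightarrow> \<bar>a x\<bar> \<le> C"
proof -
  obtain M where m: "{t \<in> {0..1}. \<bar>a t\<bar> \<le> M} \<in> lmeasurable" (is "?A \<in> _")
    and gt: "measure lebesgue {t \<in> {0..1}. \<bar>a t\<bar> \<le> M} > 3/4"
    using measurable_bounded_on_large_subset[OF a, of "3/4"] by auto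
  have "\<bar>a x\<bar> \<le> 2 * M" if x: "x \<in> {0..1/2}" for x
  proof -
    let ?B = "(+) x ` ?A"
    have mB: "?B \<in> lmeasurable" using m by (rule measurable_translation)
    \<comment> \<open>Both sets lie in \<open>{0..3/2}\<close> and each has measure above 3/4, so
      they are too large to be disjoint.\<close>
    have "?A \<inter> ?B \<noteq> {}"
    proof
      assume "?A \<inter> ?B = {}"
      then have "measure lebesgue (?A \<union> ?B) = 2 * measure lebesgue ?A"
        using measure_Un3[OF m mB] by (simp add: measure_translation)
      moreover have "measure lebesgue (?A \<union> ?B) \<le> measure lebesgue {0..3/2::real}"
      proof (rule measure_mono_fmeasurable)
        show "?A \<union> ?B \<subseteq> {0..3/2}" using x by auto
        show "?A \<union> ?B \<in> sets lebesgue" using m mB by blast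
      qed simp
      moreover have "measure lebesgue {0..3/2::real} = 3/2" by simp
      ultimately show False using gt by linarith
    qed
    then obtain t where "\<bar>a t\<bar> \<le> M" "\<bar>a (x + t)\<bar> \<le> M" by auto
    with add[of x t] show ?thesis by linarith
  qed
  then show ?thesis by (rule that)
qed

lemma additive_of_nat_mult:
  fixes a :: "real \<Rightarrow> real"
  assumes add: "\<And>s t. a (s + t) = a s + a t"
  shows "a (of_nat n * x) = of_nat n * a x"
proof (induction n)
  case 0
  then show ?case using add[of 0 0] by simp
next
  case (Suc n)
  then show ?case using add[of x "of_nat n * x"] by (simp add: algebra_simps)
qed

lemma additive_of_int_mult:
  fixes a :: "real \<Rightarrow> real"
  assumes add: "\<And>s t. a (s + t) = a s + a t"
  shows "a (of_int k * x) = of_int k * a x"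
proof (cases k)
  case (nonneg n)
  then show ?thesis using additive_of_nat_mult[of a, OF add] by simp
next
  case (neg n)
  have "a (of_int k * x) + a (of_nat (Suc n) * x) = a 0"
    unfolding add[symmetric] neg by (simp add: algebra_simps)
  moreover have "a 0 = 0" using add[of 0 0] by simp
  ultimately have "a (of_int k * x) = - a (of_nat (Suc n) * x)" by linarith
  also have "\<dots> = of_int k * a x"
    unfolding additive_of_nat_mult[of a, OF add] neg by (simp add: algebra_simps)
  finally show ?thesis .
qed

lemma additive_measurable_linear:
  fixes a :: "real \<Rightarrow> real"
  assumes a: "a \<in> borel_measurable lebesgue"
    and add: "\<And>s t. a (s + t) = a s + a t"
  shows "a t = a 1 * t"
proof -
  \<comment> \<open>Subtracting the linear part makes \<open>b\<close> vanish at 1, hence at 1/2, so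
    additivity gives it period 1/2. Its bound on \<open>{0..1/2}\<close> thus holds everywhere, and
    \<open>b (n * t) = n * b t\<close> then leaves only \<open>b t = 0\<close>.\<close>
  define b where "b = (\<lambda>x. a x - a 1 * x)"
  have addb: "b (s + t) = b s + b t" for s t
    unfolding b_def add by (simp add: algebra_simps)
  have "b \<in> borel_measurable lebesgue"
    unfolding b_def
    by (intro borel_measurable_diff a measurable_completion) simp
  then obtain C where C: "\<And>x. x \<in> {0..1/2} \<Longrightarrow> \<bar>b x\<bar> \<le> C"
    using additive_measurable_bounded addb by blast
  have "b 1 = 0" unfolding b_def by simp
  then have half: "b (1/2) = 0" using addb[of "1/2" "1/2"] by simp
  have "real n * \<bar>b t\<bar> \<le> C" for n
  proof -
    \<comment> \<open>Reduction of \<open>n * t\<close> modulo the period 1/2, with remainder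
      \<open>r\<close>.\<close>
    define k where "k = \<lfloor>2 * (real n * t)\<rfloor>"
    define r where "r = real n * t - of_int k * (1/2)"
    have "r \<in> {0..1/2}" unfolding r_def k_def by (simp, linarith)
    moreover have "b (real n * t) = b (of_int k * (1/2)) + b r"
      unfolding addb[symmetric] r_def by simp
    then have "real n * b t = b r"
      using additive_of_nat_mult[of b n t, OF addb] additive_of_int_mult[of b k "1/2", OF addb] half
      by simp
    ultimately show ?thesis using C[of r] by (metis abs_mult abs_of_nat)
  qed
  then have "\<not> 0 < \<bar>b t\<bar>"
    using ex_less_of_nat_mult[of "\<bar>b t\<bar>" C] by (meson not_less)
  then have "b t = 0" by simp
  then show ?thesis unfolding b_def by simp
qed

section \<open>Differences of polynomials\<close>

lemma degree_le_if_coeff_Suc_eq_0: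
  assumes "degree p \<le> Suc n" "coeff p (Suc n) = 0"
  shows "degree p \<le> n"
  using assms by (metis le_SucE leading_coeff_0_iff degree_0 le0)

lemma degree_pcompose_shift [simp]:
  fixes p :: "real poly"
  shows "degree (pcompose p [:t, 1:]) = degree p"
  by (simp add: degree_pcompose)

text \<open>An upper bound \<open>n\<close> replaces the exact degree because the degree of the
  polynomial \<open>p t\<close> used below may drop for some \<open>t\<close>.\<close>

lemma coeff_pcompose_shift:
  fixes p :: "real poly"
  assumes "degree p \<le> n"
  shows "coeff (pcompose p [:t, 1:]) n = coeff p n"
proof (cases "degree p = n")
  case True
  then show ?thesis using lead_coeff_comp[of "[:t, 1:]" p] by simp
next
  case False
  then show ?thesis using assms by (simp add: coeff_eq_0)
qed

text \<open>Recovers a coefficient from values along the integers; this is what makes the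
  coefficient of \<Delta>_t f measurable in t.\<close>

lemma poly_div_power_tendsto_coeff:
  fixes p :: "real poly"
  assumes "degree p \<le> n"
  shows "(\<lambda>k. poly p (real k) / real k ^ n) \<longlonglongrightarrow> coeff p n"
  using assms
proof (induction n arbitrary: p)
  case 0
  then obtain c where "p = [:c:]" using degree_eq_zeroE by blast
  then show ?case by simp
next
  case (Suc n)
  obtain c q where p: "p = pCons c q" by (cases p)
  then have "degree q \<le> n" using Suc.prems by (auto split: if_splits)
  then have q: "(\<lambda>k. poly q (real k) / real k ^ n) \<longlonglongrightarrow> coeff q n" by (rule Suc.IH)
  have "(\<lambda>k. c * inverse (real k) ^ Suc n) \<longlonglongrightarrow> c * 0 ^ Suc n"
    by (intro tendsto_intros lim_inverse_n)
  then have "(\<lambda>k. c * inverse (real k) ^ Suc n + poly q (real k) / real k ^ n) \<longlonglongrightarrow> coeff p (Suc n)"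
    using tendsto_add[OF _ q] p by fastforce
  moreover have "\<forall>\<^sub>F k in sequentially.
      c * inverse (real k) ^ Suc n + poly q (real k) / real k ^ n = poly p (real k) / real k ^ Suc n"
    using eventually_gt_at_top[of 0]
    by eventually_elim (simp add: p field_simps)
  ultimately show ?case by (rule Lim_transform_eventually)
qed

text \<open>The recursion peels off the outermost operator, whereas the inductions below need the
  one applied directly to \<open>f\<close>.\<close>

lemma iter_diff_Suc_inner:
  "iter_diff (Suc n) t f = iter_diff n (t \<circ> Suc) (diff_op (t 0) f)"
  by (induction n) auto

lemma diff_op_poly: "diff_op t (poly p) = poly (pcompose p [:t, 1:] - p)"
  by (simp add: diff_op_def poly_pcompose add.commute fun_eq_iff)

text \<open>A bound \<open>degree p < n\<close> would exclude the zero polynomial at \<open>n = 0\<close>.\<close>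

lemma iter_diff_poly_eq_0:
  assumes "degree p \<le> n" "coeff p n = 0"
  shows "iter_diff n t (poly p) x = 0"
  using assms
proof (induction n arbitrary: p t)
  case 0
  then obtain c where "p = [:c:]" using degree_eq_zeroE by blast
  then show ?case using 0 by simp
next
  case (Suc n)
  then have d: "degree p \<le> n" using degree_le_if_coeff_Suc_eq_0 by blast
  let ?q = "pcompose p [:t 0, 1:] - p"
  have "degree ?q \<le> n" using d by (intro degree_diff_le) auto
  moreover have "coeff ?q n = 0" using d by (simp add: coeff_pcompose_shift)
  ultimately show ?case
    unfolding iter_diff_Suc_inner diff_op_poly by (rule Suc.IH)
qed

section \<open>Functions annihilated by differences\<close>

text \<open>The induction generalizes over \<open>f\<close> because its hypothesis is used for two
  functions, \<open>diff_op t f\<close> and \<open>g\<close>.\<close>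

lemma poly_if_iter_diff_eq_0:
  fixes f :: "real \<Rightarrow> real"
  assumes "f \<in> borel_measurable lebesgue"
    and "\<And>t x. iter_diff (Suc d) t f x = 0"
  shows "\<exists>p. degree p \<le> d \<and> f = poly p"
  using assms
proof (induction d arbitrary: f)
  case 0
  have "f x = f 0" for x
    \<comment> \<open>A single difference with step \<open>x\<close>, taken at 0, compares
      \<open>f x\<close> with \<open>f 0\<close>.\<close>
    using "0.prems"(2)[of "\<lambda>_. x" 0] by (simp add: diff_op_def)
  then have "f = poly [:f 0:]" by auto
  then show ?case by (metis degree_pCons_0 order_refl)
next
  case (Suc d)
  note f = Suc.prems(1)
  have "\<exists>p. degree p \<le> d \<and> diff_op t f = poly p" for t
  proof (rule Suc.IH)
    show "diff_op t f \<in> borel_measurable lebesgue"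
      unfolding diff_op_def by (intro borel_measurable_diff borel_measurable_lebesgue_translate[OF f] f)
    show "iter_diff (Suc d) s (diff_op t f) x = 0" for s x
      \<comment> \<open>\<open>case_nat t s\<close> puts \<open>t\<close> in front of the sequence
        \<open>s\<close>, making it the innermost step.\<close>
      using Suc.prems(2)[of "case_nat t s" x]
      by (subst (asm) iter_diff_Suc_inner) (simp add: comp_def)
  qed
  then obtain p where deg: "\<And>t. degree (p t) \<le> d" and p: "\<And>t. diff_op t f = poly (p t)"
    by metis
  have p': "f (x + t) - f x = poly (p t) x" for t x
    using p[of t] by (simp add: diff_op_def fun_eq_iff)
  define a where "a t = coeff (p t) d" for t
  have "a (s + t) = a s + a t" for s t
  proof -
    have "poly (p (s + t)) x = poly (pcompose (p s) [:t, 1:] + p t) x" for x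
      using p'[of x "s + t"] p'[of "x + t" s] p'[of x t]
      by (simp add: poly_pcompose algebra_simps)
    then have "p (s + t) = pcompose (p s) [:t, 1:] + p t"
      using poly_eq_poly_eq_iff by blast
    then show ?thesis unfolding a_def using deg by (simp add: coeff_pcompose_shift)
  qed
  moreover have "a \<in> borel_measurable lebesgue"
  proof (rule borel_measurable_LIMSEQ_real)
    show "(\<lambda>k. (f (t + real k) - f (real k)) / real k ^ d) \<longlonglongrightarrow> a t" for t
      using poly_div_power_tendsto_coeff[OF deg[of t]]
      unfolding a_def p'[symmetric] by (simp add: add.commute)
    show "(\<lambda>t. (f (t + real k) - f (real k)) / real k ^ d) \<in> borel_measurable lebesgue" for k
      by (intro borel_measurable_divide borel_measurable_diff borel_measurable_const
          borel_measurable_lebesgue_translate[OF f])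
  qed
  ultimately have lin: "a t = a 1 * t" for t
    using additive_measurable_linear by blast
  \<comment> \<open>The difference of \<open>x ^ Suc d\<close> with step \<open>t\<close> has
    \<open>Suc d * t\<close> as its coefficient at \<open>x ^ d\<close>; dividing by
    \<open>Suc d\<close> makes that of \<open>q\<close> equal to
    \<open>a 1 * t = a t\<close>.\<close>
  define q where "q = monom (a 1 / real (Suc d)) (Suc d)"
  define g where "g = (\<lambda>x. f x - poly q x)"
  have "\<exists>r. degree r \<le> d \<and> g = poly r"
  proof (rule Suc.IH)
    have "poly q \<in> borel_measurable lebesgue"
      by (intro measurable_completion)
         (simp add: borel_measurable_continuous_onI continuous_on_poly)
    then show "g \<in> borel_measurable lebesgue"
      unfolding g_def by (intro borel_measurable_diff f)
    show "iter_diff (Suc d) s g x = 0" for s x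
    proof -
      \<comment> \<open>After the innermost step, \<open>d\<close> differences remain. They
        annihilate \<open>diff_op t g\<close> once it is a polynomial of degree at most
        \<open>d\<close> whose coefficient at \<open>x ^ d\<close> vanishes.\<close>
      define t where "t = s 0"
      define u where "u = pcompose q [:t, 1:] - q"
      have dq: "degree q \<le> Suc d" unfolding q_def by (rule degree_monom_le)
      have "degree u \<le> Suc d" unfolding u_def using dq by (intro degree_diff_le) auto
      then have du: "degree u \<le> d"
      proof (rule degree_le_if_coeff_Suc_eq_0)
        show "coeff u (Suc d) = 0" unfolding u_def by (simp add: coeff_pcompose_shift[OF dq])
      qed
      have "pcompose q [:t, 1:] = smult (a 1 / real (Suc d)) ([:t, 1:] ^ Suc d)"
        by (intro iffD1[OF poly_eq_poly_eq_iff] ext)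
           (simp add: q_def poly_pcompose poly_monom algebra_simps)
      then have "coeff u d = a t"
        unfolding u_def
        using coeff_linear_poly_power[of d "Suc d" t 1]
        by (subst lin) (simp add: q_def field_simps del: power_Suc)
      then have "coeff (p t - u) d = 0" unfolding a_def by simp
      moreover have "degree (p t - u) \<le> d" using deg du by (intro degree_diff_le)
      moreover have "diff_op t g = poly (p t - u)"
        using p'[of _ t] diff_op_poly[of t q]
        by (auto simp: g_def u_def diff_op_def fun_eq_iff algebra_simps)
      ultimately show ?thesis
        unfolding iter_diff_Suc_inner t_def[symmetric] by (simp add: iter_diff_poly_eq_0)
    qed
  qed
  then obtain r where r: "degree r \<le> d" "g = poly r" by blast
  have "f = poly (r + q)"
    using r(2) unfolding g_def by (auto simp: fun_eq_iff algebra_simps)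
  moreover have "degree (r + q) \<le> Suc d"
    using r(1) unfolding q_def by (intro degree_add_le degree_monom_le) auto
  ultimately show ?case by blast
qed

theorem theorem1p1:
  fixes f :: "real \<Rightarrow> real" and d :: nat
  assumes "f \<in> borel_measurable lebesgue"
    and "\<forall>(t :: nat \<Rightarrow> real) (x :: real). iter_diff (d + 1) t f x = 0"
  shows "\<exists>a :: nat \<Rightarrow> real. \<forall>x. f x = (\<Sum>i\<le>d. a i * x ^ i)"
proof -
  obtain p where p: "degree p \<le> d" "f = poly p"
    using poly_if_iter_diff_eq_0[of f d] assms by auto
  have "f x = (\<Sum>i\<le>d. coeff p i * x ^ i)" for x
    unfolding p(2) poly_altdef using p(1)
    by (intro sum.mono_neutral_left) (auto simp: coeff_eq_0)
  then show ?thesis by blast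
qed

end
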